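(* Let $H$ be a connected hypergraph with sink vertex $q$ and nonsink vertices $[n]$. Then the assignment ${\mathcal O} \mapsto \vec{c}({\mathcal O})$, where $\vec{c}({\mathcal O})_i = \mathrm{indeg}_{\mathcal O}(i) - 1$ for each $i \in [n]$ (the indegree being taken in the orientation of the bipartite incidence graph $B(H)$ induced by ${\mathcal O}$), defines a bijection between the set of acyclic orientations of $H$ with unique source $q$ and the set of maximal $H$-parking functions on $H$.
   Context: A hypergraph $H=(V,E)$ consists of a finite vertex set $V$ and a set $E$ of nonempty subsets of $V$, called (hyper)edges. $H$ is connected if for any two vertices $v_1,v_2$ there is a sequence of hyperedges $(e_1,\dots,e_m)$ with $v_1\in e_1$, $v_2\in e_m$ and $e_i\cap e_{i+1}\neq\emptyset$ for $i=1,\dots,m-1$. One vertex $q\in V$ is fixed as the sink, and the other vertices are identified with $[n]=\{1,\dots,n\}$. For nonempty $T\subseteq V$ and $v\in T$, set $\deg_T(v)=|\{e\in E: v\in e \text{ and } e\not\subseteq T\}|$. An $H$-parking function is a vector $\vec{c}\in\mathbb{Z}_{\ge 0}^n$ such that for every nonempty $T\subseteq[n]$ there is $i\in T$ with $c_i<\deg_T(i)$. "Maximal" means maximal for the coordinatewise partial order. The bipartite incidence graph $B(H)$ has vertex set $E\sqcup V$ and an edge between $e\in E$ and $v\in V$ whenever $v\in e$. An orientation of $H$ is a choice ${\mathcal O}=\{v_e\}_{e\in E}$ of one vertex $v_e\in e$ for each hyperedge $e$. It induces an orientation of the graph $B(H)$: for $v\in e$, the edge between $v$ and $e$ is directed from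 $v$ to $e$ if $v=v_e$, and from $e$ to $v$ otherwise. The orientation ${\mathcal O}$ is acyclic with unique source $q$ if the induced orientation of $B(H)$ has no directed cycles and $q$ is its only vertex of indegree $0$. *)

theory Defs
  imports "Graph_Theory.Graph_Theory" "HOL-Library.FuncSet"
begin

definition hypergraph :: "'a set \<Rightarrow> 'a set set \<Rightarrow> bool" where
  "hypergraph V E \<longleftrightarrow> finite V \<and> (\<forall>e\<in>E. e \<subseteq> V \<and> e \<noteq> {})"

text \<open>Only distinct vertices have to be joined, so that a single vertex without hyperedges is
  connected.\<close>

definition connected_hypergraph :: "'a set \<Rightarrow> 'a set set \<Rightarrow> bool" where
  "connected_hypergraph V E \<longleftrightarrow> hypergraph V E \<and>
     (\<forall>v1\<in>V. \<forall>v2\<in>V. v1 \<noteq> v2 \<longrightarrow>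
        (\<exists>es. es \<noteq> [] \<and> set es \<subseteq> E \<and> v1 \<in> hd es \<and> v2 \<in> last es \<and>
              (\<forall>i. Suc i < length es \<longrightarrow> es ! i \<inter> es ! Suc i \<noteq> {})))"

definition deg_out :: "'a set set \<Rightarrow> 'a set \<Rightarrow> 'a \<Rightarrow> nat" where
  "deg_out E T v = card {e \<in> E. v \<in> e \<and> \<not> e \<subseteq> T}"

text \<open>Vectors indexed by the nonsink vertices are functions that are extensional on
  \<^term>\<open>V - {q}\<close>.\<close>

definition parking_functions :: "'a set \<Rightarrow> 'a set set \<Rightarrow> 'a \<Rightarrow> ('a \<Rightarrow> int) set" where
  "parking_functions V E q =
     {c \<in> (V - {q}) \<rightarrow>\<^sub>E {0..}.
        \<forall>T. T \<noteq> {} \<and> T \<subseteq> V - {q} \<longrightarrow> (\<exists>i\<in>T. c i < int (deg_out E T i))}"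

definition maximal_parking_functions :: "'a set \<Rightarrow> 'a set set \<Rightarrow> 'a \<Rightarrow> ('a \<Rightarrow> int) set" where
  "maximal_parking_functions V E q =
     {c \<in> parking_functions V E q.
        \<forall>c' \<in> parking_functions V E q. (\<forall>i\<in>V - {q}. c i \<le> c' i) \<longrightarrow> c' = c}"

definition orientations :: "'a set set \<Rightarrow> ('a set \<Rightarrow> 'a) set" where
  "orientations E = (\<Pi>\<^sub>E e\<in>E. e)"

text \<open>The incident pairs are the edges of the bipartite incidence graph, whose vertex set is the
  disjoint sum of the hyperedges (left) and the vertices (right). An orientation of the hypergraph
  turns each of these edges into an arc by fixing its tail and head.\<close>

definition incidences :: "'a set set \<Rightarrow> ('a set \<times> 'a) set" where
  "incidences E = {(e, v). e \<in> E \<and> v \<in> e}"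

definition induced_orientation ::
  "'a set \<Rightarrow> 'a set set \<Rightarrow> ('a set \<Rightarrow> 'a) \<Rightarrow> ('a set + 'a, 'a set \<times> 'a) pre_digraph" where
  "induced_orientation V E f =
     \<lparr> verts = E <+> V,
       arcs = incidences E,
       tail = (\<lambda>(e, v). if v = f e then Inr v else Inl e),
       head = (\<lambda>(e, v). if v = f e then Inl e else Inr v) \<rparr>"

definition acyclic_orientations_unique_source ::
  "'a set \<Rightarrow> 'a set set \<Rightarrow> 'a \<Rightarrow> ('a set \<Rightarrow> 'a) set" where
  "acyclic_orientations_unique_source V E q =
     {f \<in> orientations E.
        (\<nexists>p. pre_digraph.cycle (induced_orientation V E f) p) \<and>
        {x \<in> verts (induced_orientation V E f).
           in_degree (induced_orientation V E f) x = 0} = {Inr q}}"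

definition orientation_vector ::
  "'a set \<Rightarrow> 'a set set \<Rightarrow> 'a \<Rightarrow> ('a set \<Rightarrow> 'a) \<Rightarrow> 'a \<Rightarrow> int" where
  "orientation_vector V E q f =
     (\<lambda>i\<in>V - {q}. int (in_degree (induced_orientation V E f) (Inr i)) - 1)"

end

theory Submission
  imports Defs
begin

text \<open>
  Read an orientation \<open>f\<close> as a precedence relation on the vertices: \<open>f e\<close> comes before every other
  vertex of \<open>e\<close>. A directed walk in the incidence graph alternates between vertices and hyperedges,
  so \<open>f\<close> is acyclic iff this relation is well-founded, and the indegree of a vertex \<open>v\<close> is the
  number of hyperedges through \<open>v\<close> in which another vertex was chosen. The proof combines four observations.

  \<^item> The vector of an acyclic orientation is a parking function: in a set \<open>T\<close> of nonsink vertices take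
  a minimal vertex \<open>i\<close> of the precedence relation; each hyperedge that enters \<open>i\<close> has its chosen
  vertex outside \<open>T\<close> (\<open>orientation_vector_parking\<close>).

  \<^item> Every parking function \<open>c\<close> lies below the vector of some acyclic orientation. Dhar's burning
  algorithm lists the vertices, starting at \<open>q\<close>, such that \<open>c i\<close> is smaller than the number of
  hyperedges through \<open>i\<close> that contain an earlier vertex; choose in each hyperedge its earliest
  vertex (\<open>parking_function_below_orientation_vector\<close>).

  \<^item> All vectors of orientations with source \<open>q\<close> have the same coordinate sum, because a hyperedge
  \<open>e\<close> contributes \<open>card e - 1\<close> to the indegrees of the vertices. So two comparable vectors are equal.
  With the first two observations, the vectors of acyclic orientations are exactly the maximal
  parking functions.

  \<^item> Two acyclic orientations with the same indegrees agree: among the chosen vertices of the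
  hyperedges on which they differ, a minimal one would, by equality of the indegrees, have a
  predecessor of the same kind (\<open>orientation_determined_by_indegrees\<close>).
\<close>

section \<open>Orientations as precedence relations\<close>

definition precedence :: "'a set set \<Rightarrow> ('a set \<Rightarrow> 'a) \<Rightarrow> 'a rel" where
  "precedence E f = {(f e, v) | e v. e \<in> E \<and> v \<in> e \<and> v \<noteq> f e}"

definition entering :: "'a set set \<Rightarrow> ('a set \<Rightarrow> 'a) \<Rightarrow> 'a \<Rightarrow> 'a set set" where
  "entering E f v = {e \<in> E. v \<in> e \<and> f e \<noteq> v}"

lemma hypergraph_finite_edges: "hypergraph V E \<Longrightarrow> finite E"
  unfolding hypergraph_def by (meson Pow_iff finite_Pow_iff finite_subset subsetI)

lemma in_degree_vertex:
  "in_degree (induced_orientation V E f) (Inr v) = card (entering E f v)"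
proof -
  have "in_arcs (induced_orientation V E f) (Inr v) = (\<lambda>e. (e, v)) ` entering E f v"
    by (auto simp: in_arcs_def induced_orientation_def incidences_def entering_def
        split: if_splits)
  then show ?thesis
    by (simp add: in_degree_def card_image inj_on_def)
qed

lemma in_degree_hyperedge:
  assumes "f \<in> orientations E" "e \<in> E"
  shows "in_degree (induced_orientation V E f) (Inl e) = 1"
proof -
  have "f e \<in> e"
    using assms by (auto simp: orientations_def)
  then have "in_arcs (induced_orientation V E f) (Inl e) = {(e, f e)}"
    using assms(2)
    by (auto simp: in_arcs_def induced_orientation_def incidences_def split: if_splits)
  then show ?thesis
    by (simp add: in_degree_def)
qed

text \<open>A step of the precedence relation is a walk of length two through a hyperedge, so a cycle of
  the relation gives a closed walk, which contains a cycle.\<close>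

lemma wf_precedence_if_no_cycle:
  assumes hyp: "hypergraph V E" and f: "f \<in> orientations E"
    and no_cycle: "\<nexists>p. pre_digraph.cycle (induced_orientation V E f) p"
  shows "wf (precedence E f)"
proof -
  let ?G = "induced_orientation V E f"
  have fe: "f e \<in> e" if "e \<in> E" for e
    using f that by (auto simp: orientations_def)
  have sub: "e \<subseteq> V" if "e \<in> E" for e
    using hyp that by (auto simp: hypergraph_def)
  interpret wf_digraph ?G
    using subsetD[OF sub] fe
    by unfold_locales (auto simp: induced_orientation_def incidences_def Plus_def)
  have step: "Inr u \<rightarrow>\<^sup>+\<^bsub>?G\<^esub> Inr v" if "(u, v) \<in> precedence E f" for u v
  proof -
    from that obtain e where e: "e \<in> E" "u = f e" "v \<in> e" "v \<noteq> f e"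
      by (auto simp: precedence_def)
    then have "awalk (Inr u) [(e, u), (e, v)] (Inr v)"
      using fe[OF e(1)] sub[OF e(1)]
      by (simp add: awalk_simps, simp add: induced_orientation_def incidences_def InrI subsetD)
    then show ?thesis
      by (rule reachable1_awalkI) simp
  qed
  have walk: "Inr u \<rightarrow>\<^sup>+\<^bsub>?G\<^esub> Inr v" if "(u, v) \<in> (precedence E f)\<^sup>+" for u v
    using that by (induction rule: trancl_induct) (auto dest: step intro: trancl_trans)
  have "acyclic (precedence E f)"
  proof (rule acyclicI, intro allI notI)
    fix v
    assume "(v, v) \<in> (precedence E f)\<^sup>+"
    then obtain p where "awalk (Inr v) p (Inr v)" "p \<noteq> []"
      using walk reachable1_awalk by metis
    then have "closed_w p"
      by (auto simp: closed_w_def)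
    then show False
      using closed_w_imp_cycle no_cycle by blast
  qed
  moreover have "finite (precedence E f)"
  proof (rule finite_subset)
    show "precedence E f \<subseteq> V \<times> V"
      using fe sub by (fastforce simp: precedence_def)
    show "finite (V \<times> V)"
      using hyp by (simp add: hypergraph_def)
  qed
  ultimately show ?thesis
    by (simp add: finite_acyclic_wf)
qed

text \<open>Each hyperedge is placed between its chosen vertex and its other vertices, so that the rank of
  the vertices extends to a potential that grows along all arcs.\<close>

lemma no_cycle_if_rank:
  fixes r :: "'a \<Rightarrow> nat"
  assumes rank: "precedence E f \<subseteq> measure r"
  shows "\<nexists>p. pre_digraph.cycle (induced_orientation V E f) p"
proof -
  let ?G = "induced_orientation V E f"
  define h where "h = case_sum (\<lambda>e. 2 * r (f e) + 1) (\<lambda>v. 2 * r v)"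
  have arc: "h (tail ?G a) < h (head ?G a)" if "a \<in> arcs ?G" for a
  proof -
    obtain e v where a: "a = (e, v)" "e \<in> E" "v \<in> e"
      using \<open>a \<in> arcs ?G\<close> by (auto simp: induced_orientation_def incidences_def)
    have "r (f e) < r v" if "v \<noteq> f e"
    proof -
      have "(f e, v) \<in> precedence E f"
        using a that by (auto simp: precedence_def)
      then show ?thesis
        using rank by auto
    qed
    then show ?thesis
      by (auto simp: a(1) induced_orientation_def h_def)
  qed
  have walk: "h u < h v"
    if "pre_digraph.cas ?G u p v" "set p \<subseteq> arcs ?G" "p \<noteq> []" for u v p
    using that
  proof (induction p arbitrary: u)
    case (Cons a p)
    then have a: "u = tail ?G a" "pre_digraph.cas ?G (head ?G a) p v" "a \<in> arcs ?G"
      by (simp_all add: pre_digraph.cas.simps)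
    show ?case
    proof (cases "p = []")
      case True
      then show ?thesis
        using a arc[OF a(3)] by (simp add: pre_digraph.cas.simps)
    next
      case False
      then have "h (head ?G a) < h v"
        using Cons.IH[OF a(2)] Cons.prems(2) by simp
      then show ?thesis
        using a(1) arc[OF a(3)] by simp
    qed
  qed simp
  show ?thesis
    using walk by (metis less_irrefl pre_digraph.awalk_def pre_digraph.cycle_def)
qed

lemma acyclic_orientationsD:
  assumes "hypergraph V E" "q \<in> V" "f \<in> acyclic_orientations_unique_source V E q"
  shows "f \<in> orientations E" "wf (precedence E f)"
    "\<And>v. v \<in> V \<Longrightarrow> card (entering E f v) = 0 \<longleftrightarrow> v = q"
proof -
  show f: "f \<in> orientations E" and "wf (precedence E f)"
    using assms wf_precedence_if_no_cycle[of V E f]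
    by (auto simp: acyclic_orientations_unique_source_def)
  fix v
  assume "v \<in> V"
  let ?G = "induced_orientation V E f"
  have "in_degree ?G (Inr v) = 0 \<longleftrightarrow> Inr v \<in> {x \<in> verts ?G. in_degree ?G x = 0}"
    using \<open>v \<in> V\<close> by (simp add: induced_orientation_def InrI)
  also have "{x \<in> verts ?G. in_degree ?G x = 0} = {Inr q}"
    using assms(3) by (simp add: acyclic_orientations_unique_source_def)
  finally have "in_degree ?G (Inr v) = 0 \<longleftrightarrow> v = q"
    by simp
  then show "card (entering E f v) = 0 \<longleftrightarrow> v = q"
    by (simp add: in_degree_vertex)
qed

lemma acyclic_orientationsI:
  fixes r :: "'a \<Rightarrow> nat"
  assumes "q \<in> V" "f \<in> orientations E" "precedence E f \<subseteq> measure r"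
    and source: "\<And>v. v \<in> V \<Longrightarrow> card (entering E f v) = 0 \<longleftrightarrow> v = q"
  shows "f \<in> acyclic_orientations_unique_source V E q"
proof -
  have "verts (induced_orientation V E f) = E <+> V"
    by (simp add: induced_orientation_def)
  then have "{x \<in> verts (induced_orientation V E f).
      in_degree (induced_orientation V E f) x = 0} = {Inr q}"
    using assms(1) source in_degree_hyperedge[OF assms(2)] by (auto simp: in_degree_vertex)
  then show ?thesis
    using assms(2) no_cycle_if_rank[OF assms(3)]
    by (simp add: acyclic_orientations_unique_source_def)
qed

lemma orientation_vector_apply:
  "i \<in> V - {q} \<Longrightarrow> orientation_vector V E q f i = int (card (entering E f i)) - 1"
  by (simp add: orientation_vector_def in_degree_vertex)

section \<open>Orientations and parking functions\<close>

lemma orientation_vector_parking: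
  assumes hyp: "hypergraph V E" and q: "q \<in> V"
    and f: "f \<in> acyclic_orientations_unique_source V E q"
  shows "orientation_vector V E q f \<in> parking_functions V E q"
proof -
  note facts = acyclic_orientationsD[OF hyp q f]
  have "\<exists>i\<in>T. orientation_vector V E q f i < int (deg_out E T i)"
    if T: "T \<noteq> {}" "T \<subseteq> V - {q}" for T
  proof -
    obtain i where i: "i \<in> T" and min: "\<And>u. (u, i) \<in> precedence E f \<Longrightarrow> u \<notin> T"
      using facts(2) T(1) by (metis ex_in_conv wfE_min)
    have "entering E f i \<subseteq> {e \<in> E. i \<in> e \<and> \<not> e \<subseteq> T}"
    proof
      fix e
      assume e: "e \<in> entering E f i"
      then have "f e \<notin> T"
        by (intro min) (auto simp: entering_def precedence_def)
      moreover have "f e \<in> e"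
        using facts(1) e by (auto simp: orientations_def entering_def)
      ultimately show "e \<in> {e \<in> E. i \<in> e \<and> \<not> e \<subseteq> T}"
        using e by (auto simp: entering_def)
    qed
    then have "card (entering E f i) \<le> deg_out E T i"
      unfolding deg_out_def using hypergraph_finite_edges[OF hyp] by (simp add: card_mono)
    then show ?thesis
      using i T(2) by (intro bexI[of _ i]) (auto simp: orientation_vector_apply subset_iff)
  qed
  moreover have "orientation_vector V E q f \<in> (V - {q}) \<rightarrow>\<^sub>E {0..}"
  proof (rule PiE_I)
    fix i
    assume i: "i \<in> V - {q}"
    then have "card (entering E f i) \<noteq> 0"
      using facts(3)[of i] by blast
    then show "orientation_vector V E q f i \<in> {0..}"
      using i by (simp add: orientation_vector_apply)
  qed (auto simp: orientation_vector_def)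
  ultimately show ?thesis
    by (simp add: parking_functions_def)
qed

text \<open>Dhar's burning algorithm: the parking condition supplies a vertex of \<open>T\<close> that can burn first,
  and then burning continues in the rest of \<open>T\<close>. The ranks record the burning times.\<close>

lemma burning_order:
  fixes c :: "'a \<Rightarrow> int"
  assumes "finite T"
    and "\<And>S. S \<noteq> {} \<Longrightarrow> S \<subseteq> T \<Longrightarrow> \<exists>i\<in>S. c i < int (deg_out E S i)"
  shows "\<exists>r :: 'a \<Rightarrow> nat. inj_on r T \<and> (\<forall>i\<in>T. c i < int (deg_out E {j \<in> T. r i \<le> r j} i))"
  using assms
proof (induction T rule: finite_psubset_induct)
  case (psubset T)
  show ?case
  proof (cases "T = {}")
    case False
    then obtain k where k: "k \<in> T" "c k < int (deg_out E T k)"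
      using psubset.prems[of T] by auto
    have "T - {k} \<subset> T"
      using k by auto
    moreover have "\<exists>i\<in>S. c i < int (deg_out E S i)" if "S \<noteq> {}" "S \<subseteq> T - {k}" for S
      using psubset.prems[of S] that by auto
    ultimately have "\<exists>r :: 'a \<Rightarrow> nat. inj_on r (T - {k})
        \<and> (\<forall>i\<in>T - {k}. c i < int (deg_out E {j \<in> T - {k}. r i \<le> r j} i))"
      by (rule psubset.IH)
    then obtain r :: "'a \<Rightarrow> nat" where r: "inj_on r (T - {k})"
      "\<And>i. i \<in> T - {k} \<Longrightarrow> c i < int (deg_out E {j \<in> T - {k}. r i \<le> r j} i)"
      by auto
    define r' where "r' = (\<lambda>j. if j = k then 0 else Suc (r j))"
    have "inj_on r' T"
      using r(1) by (auto simp: inj_on_def r'_def)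
    moreover have "c i < int (deg_out E {j \<in> T. r' i \<le> r' j} i)" if "i \<in> T" for i
    proof (cases "i = k")
      case True
      then show ?thesis
        using k by (simp add: r'_def)
    next
      case False
      then have "{j \<in> T. r' i \<le> r' j} = {j \<in> T - {k}. r i \<le> r j}"
        by (auto simp: r'_def)
      then show ?thesis
        using r(2) False that by simp
    qed
    ultimately show ?thesis
      by blast
  qed simp
qed

lemma parking_function_below_orientation_vector:
  assumes hyp: "hypergraph V E" and q: "q \<in> V" and c: "c \<in> parking_functions V E q"
  shows "\<exists>f \<in> acyclic_orientations_unique_source V E q.
    \<forall>i\<in>V - {q}. c i \<le> orientation_vector V E q f i"
proof -
  have "finite (V - {q})"
    using hyp by (simp add: hypergraph_def)
  then obtain r0 :: "'a \<Rightarrow> nat" where r0: "inj_on r0 (V - {q})"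
    "\<And>i. i \<in> V - {q} \<Longrightarrow> c i < int (deg_out E {j \<in> V - {q}. r0 i \<le> r0 j} i)"
    using burning_order[of "V - {q}" c E] c by (auto simp: parking_functions_def)
  define r where "r = (\<lambda>j. if j = q then 0 else Suc (r0 j))"
  have inj: "inj_on r V"
    using r0(1) by (auto simp: inj_on_def r_def)
  define f where "f = (\<lambda>e\<in>E. arg_min_on r e)"
  have f: "f e \<in> e" "\<And>v. v \<in> e \<Longrightarrow> r (f e) \<le> r v" if "e \<in> E" for e
  proof -
    have "finite e" "e \<noteq> {}"
      using hyp that by (auto simp: hypergraph_def dest: finite_subset)
    then show "f e \<in> e" "\<And>v. v \<in> e \<Longrightarrow> r (f e) \<le> r v"
      using that arg_min_if_finite[of e r] by (auto simp: f_def not_less[symmetric])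
  qed
  have strict: "r (f e) < r v" if "e \<in> E" "v \<in> e" "v \<noteq> f e" for e v
  proof -
    have "e \<subseteq> V"
      using hyp that(1) by (auto simp: hypergraph_def)
    then have "r (f e) \<noteq> r v"
      using inj that f(1)[OF that(1)] by (metis inj_onD subsetD)
    then show ?thesis
      using f(2)[OF that(1,2)] by simp
  qed
  have below: "c i + 1 \<le> int (card (entering E f i))" if i: "i \<in> V - {q}" for i
  proof -
    have "{e \<in> E. i \<in> e \<and> \<not> e \<subseteq> {j \<in> V - {q}. r0 i \<le> r0 j}} \<subseteq> entering E f i"
    proof
      fix e
      assume e: "e \<in> {e \<in> E. i \<in> e \<and> \<not> e \<subseteq> {j \<in> V - {q}. r0 i \<le> r0 j}}"
      then obtain j where j: "j \<in> e" "j \<notin> {j \<in> V - {q}. r0 i \<le> r0 j}"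
        by auto
      have "j \<in> V"
        using hyp e j(1) by (auto simp: hypergraph_def)
      then have "r j < r i"
        using i j(2) by (auto simp: r_def)
      then have "f e \<noteq> i"
        using f(2)[of e j] e j(1) by auto
      then show "e \<in> entering E f i"
        using e by (simp add: entering_def)
    qed
    then have "deg_out E {j \<in> V - {q}. r0 i \<le> r0 j} i \<le> card (entering E f i)"
      unfolding deg_out_def
      by (intro card_mono) (auto simp: entering_def hypergraph_finite_edges[OF hyp])
    then show ?thesis
      using r0(2)[OF i] by linarith
  qed
  have "f \<in> acyclic_orientations_unique_source V E q"
  proof (rule acyclic_orientationsI[OF q])
    show "f \<in> orientations E"
      using f(1) by (auto simp: orientations_def f_def)
    show "precedence E f \<subseteq> measure r"
      using strict by (auto simp: precedence_def)
    fix v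
    assume v: "v \<in> V"
    show "card (entering E f v) = 0 \<longleftrightarrow> v = q"
    proof (cases "v = q")
      case True
      \<comment> \<open>The sink has rank 0, so it is chosen in every hyperedge that contains it.\<close>
      then have "entering E f v = {}"
        using strict[of _ q] by (fastforce simp: entering_def r_def)
      then show ?thesis
        using True by simp
    next
      case False
      then have "0 \<le> c v"
        using c v by (auto simp: parking_functions_def dest: PiE_mem)
      then show ?thesis
        using below[of v] v False by simp
    qed
  qed
  moreover have "\<forall>i\<in>V - {q}. c i \<le> orientation_vector V E q f i"
  proof
    fix i
    assume "i \<in> V - {q}"
    then show "c i \<le> orientation_vector V E q f i"
      using below[of i] by (simp add: orientation_vector_apply)
  qed
  ultimately show ?thesis
    by blast
qed

section \<open>Maximality\<close>

lemma sum_card_entering: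
  assumes hyp: "hypergraph V E" and f: "f \<in> orientations E"
  shows "(\<Sum>v\<in>V. card (entering E f v)) = (\<Sum>e\<in>E. card e - 1)"
proof -
  have fin: "finite V" "finite E"
    using hyp hypergraph_finite_edges by (auto simp: hypergraph_def)
  have "(\<Sum>v\<in>V. card (entering E f v)) = (\<Sum>e\<in>E. card (e - {f e}))"
    unfolding entering_def
  proof (rule sum_multicount_gen[OF fin])
    have "{v \<in> V. v \<in> e \<and> f e \<noteq> v} = e - {f e}" if "e \<in> E" for e
      using hyp that by (auto simp: hypergraph_def)
    then show "\<forall>e\<in>E. card {v \<in> V. v \<in> e \<and> f e \<noteq> v} = card (e - {f e})"
      by simp
  qed
  also have "\<dots> = (\<Sum>e\<in>E. card e - 1)"
    using f by (intro sum.cong refl card_Diff_singleton) (auto simp: orientations_def)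
  finally show ?thesis .
qed

lemma sum_orientation_vector:
  assumes hyp: "hypergraph V E" and q: "q \<in> V"
    and f: "f \<in> acyclic_orientations_unique_source V E q"
  shows "(\<Sum>i\<in>V - {q}. orientation_vector V E q f i)
    = int (\<Sum>e\<in>E. card e - 1) - int (card (V - {q}))"
proof -
  note facts = acyclic_orientationsD[OF hyp q f]
  have "finite V"
    using hyp by (simp add: hypergraph_def)
  then have "(\<Sum>v\<in>V. card (entering E f v)) = (\<Sum>v\<in>V - {q}. card (entering E f v))"
    using q facts(3)[OF q] by (simp add: sum.remove)
  then show ?thesis
    using sum_card_entering[OF hyp facts(1)]
    by (simp add: orientation_vector_apply sum_subtractf)
qed

lemma eq_of_le_of_sum_ge:
  fixes x y :: "'a \<Rightarrow> int"
  assumes "finite A" "\<And>i. i \<in> A \<Longrightarrow> x i \<le> y i" "sum y A \<le> sum x A" "i \<in> A"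
  shows "x i = y i"
  using assms sum_strict_mono_ex1[of A x y] by (metis leD order_le_less)

lemma orientation_vector_maximal:
  assumes hyp: "hypergraph V E" and q: "q \<in> V"
    and f: "f \<in> acyclic_orientations_unique_source V E q"
  shows "orientation_vector V E q f \<in> maximal_parking_functions V E q"
proof -
  let ?c = "orientation_vector V E q f"
  have fin: "finite (V - {q})"
    using hyp by (simp add: hypergraph_def)
  have "c = ?c" if c: "c \<in> parking_functions V E q" and le: "\<forall>i\<in>V - {q}. ?c i \<le> c i" for c
  proof -
    obtain g where g: "g \<in> acyclic_orientations_unique_source V E q"
      and cg: "\<forall>i\<in>V - {q}. c i \<le> orientation_vector V E q g i"
      using parking_function_below_orientation_vector[OF hyp q c] by blast
    have "sum c (V - {q}) \<le> sum ?c (V - {q})"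
      using sum_mono[of "V - {q}" c "orientation_vector V E q g"] cg
        sum_orientation_vector[OF hyp q f] sum_orientation_vector[OF hyp q g] by simp
    then have "?c i = c i" if "i \<in> V - {q}" for i
      using eq_of_le_of_sum_ge[OF fin, of ?c c i] le that by blast
    moreover have "c \<in> extensional (V - {q})" "?c \<in> extensional (V - {q})"
      using c by (auto simp: parking_functions_def PiE_def orientation_vector_def)
    ultimately show ?thesis
      by (metis extensionalityI)
  qed
  then show ?thesis
    using orientation_vector_parking[OF assms] by (auto simp: maximal_parking_functions_def)
qed

section \<open>Injectivity\<close>

text \<open>Let \<open>e\<close> be a hyperedge on which the orientations differ, with \<open>v = f e\<close> minimal. Then \<open>e\<close>
  enters \<open>v\<close> under \<open>g\<close> only, so equal indegrees force another hyperedge to enter \<open>v\<close> under \<open>f\<close> only.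
  Its vertex chosen by \<open>f\<close> precedes \<open>v\<close>, and the orientations differ on it as well.\<close>

lemma orientation_determined_by_indegrees:
  assumes fin: "finite E" and f: "f \<in> orientations E" and g: "g \<in> orientations E"
    and wf: "wf (precedence E f)"
    and eq: "\<And>v. v \<in> \<Union>E \<Longrightarrow> card (entering E f v) = card (entering E g v)"
  shows "f = g"
proof (rule ccontr)
  assume "f \<noteq> g"
  define D where "D = {f e | e. e \<in> E \<and> f e \<noteq> g e}"
  have "\<exists>e\<in>E. f e \<noteq> g e"
    using f g \<open>f \<noteq> g\<close> unfolding orientations_def by (metis PiE_ext)
  then have "D \<noteq> {}"
    by (auto simp: D_def)
  then obtain v where v: "v \<in> D" and min: "\<And>u. (u, v) \<in> precedence E f \<Longrightarrow> u \<notin> D"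
    using wf by (metis ex_in_conv wfE_min)
  from v obtain e where e: "e \<in> E" "v = f e" "f e \<noteq> g e"
    by (auto simp: D_def)
  have ve: "v \<in> e"
    using f e by (auto simp: orientations_def)
  have "e \<in> entering E g v - entering E f v"
    using e ve by (auto simp: entering_def)
  moreover have "card (entering E f v) = card (entering E g v)"
    using eq ve e(1) by blast
  moreover have "finite (entering E g v)"
    using fin by (simp add: entering_def)
  ultimately have "\<not> entering E f v \<subseteq> entering E g v"
    using card_subset_eq by blast
  then obtain e' where e': "e' \<in> E" "v \<in> e'" "f e' \<noteq> v" "g e' = v"
    by (auto simp: entering_def)
  then have "(f e', v) \<in> precedence E f" "f e' \<in> D"
    by (auto simp: precedence_def D_def)
  then show False
    using min by blast
qed

lemma inj_on_orientation_vector: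
  assumes hyp: "hypergraph V E" and q: "q \<in> V"
  shows "inj_on (orientation_vector V E q) (acyclic_orientations_unique_source V E q)"
proof (rule inj_onI)
  fix f g
  assume f: "f \<in> acyclic_orientations_unique_source V E q"
    and g: "g \<in> acyclic_orientations_unique_source V E q"
    and eq: "orientation_vector V E q f = orientation_vector V E q g"
  note factsf = acyclic_orientationsD[OF hyp q f] and factsg = acyclic_orientationsD[OF hyp q g]
  show "f = g"
  proof (rule orientation_determined_by_indegrees[OF hypergraph_finite_edges[OF hyp]
        factsf(1) factsg(1) factsf(2)])
    fix v
    assume "v \<in> \<Union>E"
    then have v: "v \<in> V"
      using hyp by (auto simp: hypergraph_def)
    show "card (entering E f v) = card (entering E g v)"
    proof (cases "v = q")
      case True
      then show ?thesis
        using factsf(3)[OF q] factsg(3)[OF q] by simp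
    next
      case False
      then show ?thesis
        using v fun_cong[OF eq, of v] by (simp add: orientation_vector_apply)
    qed
  qed
qed

section \<open>The bijection\<close>

theorem theorem3p10:
  fixes V :: "'a set" and E :: "'a set set" and q :: 'a
  assumes "connected_hypergraph V E" and "q \<in> V"
  shows "bij_betw (orientation_vector V E q)
           (acyclic_orientations_unique_source V E q)
           (maximal_parking_functions V E q)"
proof -
  have hyp: "hypergraph V E"
    using assms(1) by (simp add: connected_hypergraph_def)
  have "c \<in> orientation_vector V E q ` acyclic_orientations_unique_source V E q"
    if c: "c \<in> maximal_parking_functions V E q" for c
  proof -
    have "c \<in> parking_functions V E q"
      using c by (simp add: maximal_parking_functions_def)
    then obtain f where f: "f \<in> acyclic_orientations_unique_source V E q"
      "\<forall>i\<in>V - {q}. c i \<le> orientation_vector V E q f i"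
      using parking_function_below_orientation_vector[OF hyp assms(2)] by blast
    then have "orientation_vector V E q f = c"
      using c orientation_vector_parking[OF hyp assms(2) f(1)]
      by (simp add: maximal_parking_functions_def)
    then show ?thesis
      using f(1) by blast
  qed
  then show ?thesis
    using orientation_vector_maximal[OF hyp assms(2)] inj_on_orientation_vector[OF hyp assms(2)]
    by (auto simp: bij_betw_def)
qed

end
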